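(* Let $\mathcal{C}$ be a sum closed, rc-invariant permutation class, and let $\xi\approx 2.30522$ be the unique positive root of $x^5-2x^4-x^2-x-1$. If $\lim_{n\to\infty}|\mathcal{C}_n|^{1/n}\le\xi$, then $\lim_{n\to\infty}|\mathcal{C}^{rc}_{2n}|^{1/n}$ exists and equals $\lim_{n\to\infty}|\mathcal{C}_n|^{1/n}$.
   Context: A permutation of size $n$ is a bijection of $[n]$; $\pi$ contains $\sigma$ if some subsequence of $\pi$ has the same relative order as $\sigma$; a permutation class is a set of permutations closed downward under containment; $\mathcal{C}_n$ is the set of size-$n$ elements of $\mathcal{C}$. For $\pi$ of size $n$, $\mathrm{rc}(\pi)(i)=n+1-\pi(n+1-i)$; $\pi$ is centrosymmetric if $\mathrm{rc}(\pi)=\pi$; $\mathcal{C}^{rc}_n$ is the set of centrosymmetric elements of $\mathcal{C}_n$; $\mathcal{C}$ is rc-invariant if $\mathrm{rc}(\mathcal{C})=\mathcal{C}$. The sum $\sigma\oplus\tau$ of $\sigma$ (size $a$) and $\tau$ (size $b$) is given by $(\sigma\oplus\tau)(i)=\sigma(i)$ for $i\le a$ and $a+\tau(i-a)$ for $i>a$; $\mathcal{C}$ is sum closed if it is closed under $\oplus$. (For sum closed classes, $\lim_n|\mathcal{C}_n|^{1/n}$ exists.) *)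

theory Defs
  imports Complex_Main "HOL-Library.Sublist" "HOL-Combinatorics.Multiset_Permutations"
begin

text \<open>
  A permutation \<open>\<pi>\<close> of \<open>{1..n}\<close> is represented in one-line notation, by the list
  \<open>[\<pi> 1, \<dots>, \<pi> n]\<close>. Lists are indexed from 0, so \<open>\<pi> i\<close> is entry \<open>i - 1\<close> of the list.
  The empty permutation (size 0) is admitted.
\<close>

definition is_perm :: "nat list \<Rightarrow> bool" where
  "is_perm \<pi> \<longleftrightarrow> \<pi> \<in> permutations_of_set {1..length \<pi>}"

definition same_order :: "nat list \<Rightarrow> nat list \<Rightarrow> bool" where
  "same_order xs ys \<longleftrightarrow> length xs = length ys \<and>
     (\<forall>i<length xs. \<forall>j<length xs. xs ! i < xs ! j \<longleftrightarrow> ys ! i < ys ! j)"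

definition perm_contains :: "nat list \<Rightarrow> nat list \<Rightarrow> bool" where
  "perm_contains \<pi> \<sigma> \<longleftrightarrow> (\<exists>xs. subseq xs \<pi> \<and> same_order xs \<sigma>)"

definition perm_class :: "nat list set \<Rightarrow> bool" where
  "perm_class C \<longleftrightarrow> (\<forall>\<pi>\<in>C. is_perm \<pi>) \<and>
     (\<forall>\<pi>\<in>C. \<forall>\<sigma>. is_perm \<sigma> \<and> perm_contains \<pi> \<sigma> \<longrightarrow> \<sigma> \<in> C)"

definition rc :: "nat list \<Rightarrow> nat list" where
  "rc \<pi> = map (\<lambda>x. length \<pi> + 1 - x) (rev \<pi>)"

definition centrosymmetric :: "nat list \<Rightarrow> bool" where
  "centrosymmetric \<pi> \<longleftrightarrow> rc \<pi> = \<pi>"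

definition rc_invariant :: "nat list set \<Rightarrow> bool" where
  "rc_invariant C \<longleftrightarrow> rc ` C = C"

definition perm_sum :: "nat list \<Rightarrow> nat list \<Rightarrow> nat list" where
  "perm_sum \<sigma> \<tau> = \<sigma> @ map (\<lambda>x. length \<sigma> + x) \<tau>"

definition sum_closed :: "nat list set \<Rightarrow> bool" where
  "sum_closed C \<longleftrightarrow> (\<forall>\<sigma>\<in>C. \<forall>\<tau>\<in>C. perm_sum \<sigma> \<tau> \<in> C)"

definition of_size :: "nat list set \<Rightarrow> nat \<Rightarrow> nat list set" where
  "of_size C n = {\<pi>\<in>C. length \<pi> = n}"

definition rc_of_size :: "nat list set \<Rightarrow> nat \<Rightarrow> nat list set" where
  "rc_of_size C n = {\<pi>\<in>of_size C n. centrosymmetric \<pi>}"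

definition xi :: real where
  "xi = (THE x. x > 0 \<and> x ^ 5 - 2 * x ^ 4 - x ^ 2 - x - 1 = 0)"

lemma rc_entry:
  assumes "1 \<le> i" "i \<le> length \<pi>"
  shows "rc \<pi> ! (i - 1) = length \<pi> + 1 - \<pi> ! (length \<pi> + 1 - i - 1)"
  using assms by (simp add: rc_def rev_nth)

lemma perm_sum_entry:
  assumes "1 \<le> i" "i \<le> length \<sigma> + length \<tau>"
  shows "perm_sum \<sigma> \<tau> ! (i - 1) =
    (if i \<le> length \<sigma> then \<sigma> ! (i - 1) else length \<sigma> + \<tau> ! (i - length \<sigma> - 1))"
  using assms by (auto simp: perm_sum_def nth_append diff_commute)

lemma finite_of_size:
  assumes "perm_class C"
  shows "finite (of_size C n)"
proof (rule finite_subset)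
  show "of_size C n \<subseteq> permutations_of_set {1..n}"
    using assms by (auto simp: of_size_def perm_class_def is_perm_def)
qed simp

lemma xi_unique: "\<exists>!x::real. x > 0 \<and> x ^ 5 - 2 * x ^ 4 - x ^ 2 - x - 1 = 0"
  and xi_root: "xi ^ 5 - 2 * xi ^ 4 - xi ^ 2 - xi - 1 = 0"
  and xi_bounds: "2.305215 < xi" "xi < 2.305225"
proof -
  define p where "p = (\<lambda>x::real. x ^ 5 - 2 * x ^ 4 - x ^ 2 - x - 1)"
  have "\<exists>x\<ge>2.305215. x \<le> 2.305225 \<and> p x = 0"
    by (rule IVT) (auto simp: p_def power_divide intro!: continuous_intros)
  then obtain x0 where x0: "2.305215 \<le> x0" "x0 \<le> 2.305225" "p x0 = 0"
    by blast
  have "p 2.305215 \<noteq> 0" "p 2.305225 \<noteq> 0"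
    by (simp_all add: p_def power_divide)
  with x0 have strict: "2.305215 < x0" "x0 < 2.305225"
    by (metis order_le_less)+
  have no: "\<not> (p x = 0 \<and> p y = 0)" if "0 < x" "x < y" for x y
  proof
    assume "p x = 0 \<and> p y = 0"
    moreover have "1 - 2 * inverse z - inverse z ^ 3 - inverse z ^ 4 - inverse z ^ 5
        = p z * inverse z ^ 5" if "z > 0" for z :: real
      using that by (simp add: p_def field_simps power_numeral_reduce)
    ultimately have "1 - 2 * inverse x - inverse x ^ 3 - inverse x ^ 4 - inverse x ^ 5 = 0"
      "1 - 2 * inverse y - inverse y ^ 3 - inverse y ^ 4 - inverse y ^ 5 = 0"
      using that by auto
    moreover have "inverse y < inverse x" "0 \<le> inverse y"
      using that by auto
    moreover from this have "inverse y ^ k \<le> inverse x ^ k" for k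
      by (intro power_mono) auto
    from this[of 3] this[of 4] this[of 5]
    have "inverse y ^ 3 \<le> inverse x ^ 3" "inverse y ^ 4 \<le> inverse x ^ 4"
      "inverse y ^ 5 \<le> inverse x ^ 5" .
    ultimately show False by linarith
  qed
  have uniq: "x = x0" if "x > 0 \<and> p x = 0" for x
    using no[of x x0] no[of x0 x] that x0 by (cases x x0 rule: linorder_cases) auto
  have ex1: "\<exists>!x. x > 0 \<and> p x = 0"
    using x0 uniq by (intro ex1I[of _ x0]) auto
  then show "\<exists>!x::real. x > 0 \<and> x ^ 5 - 2 * x ^ 4 - x ^ 2 - x - 1 = 0"
    by (simp add: p_def)
  have "xi = (THE x. x > 0 \<and> p x = 0)"
    by (simp add: xi_def p_def)
  also have "\<dots> = x0"
    using x0 uniq by (intro the_equality) auto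
  finally have "xi = x0" .
  with x0 strict show "xi ^ 5 - 2 * xi ^ 4 - xi ^ 2 - xi - 1 = 0" "2.305215 < xi" "xi < 2.305225"
    by (simp_all add: p_def)
qed

end

theory Submission
  imports Defs
begin

text \<open>
  The map \<open>\<sigma> \<mapsto> \<sigma> \<oplus> rc \<sigma>\<close> gives \<open>|C_n| \<le> |C^rc_2n|\<close>. For the converse, cut a centrosymmetric
  \<open>\<pi>\<close> of size \<open>2n\<close> into four \<open>n \<times> n\<close> quadrants, and let \<open>k\<close> be the number of entries in the
  upper left one; these form a pattern \<open>\<alpha>\<close>, and the lower right quadrant holds \<open>rc \<alpha>\<close>. All of
  \<open>\<pi>\<close> can be recovered from the \<open>n + k\<close> entries outside the upper right quadrant, so for
  bounded \<open>k\<close> there are only \<open>O(|C_{n+k}|)\<close> such \<open>\<pi>\<close>.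

  If \<open>k\<close> is large, then \<open>C\<close> contains \<open>\<alpha> \<ominus> rc \<alpha>\<close>, hence many sum indecomposables
  \<open>\<alpha>' \<ominus> \<beta>'\<close> with \<open>\<alpha>'\<close>, \<open>\<beta>'\<close> contained in \<open>\<alpha>\<close>, \<open>rc \<alpha>\<close>. Sums over \<open>C\<close> factor uniquely into
  indecomposables, so with \<open>s_j\<close> indecomposables of size \<open>j\<close> the growth rate is at least \<open>y\<close>
  whenever \<open>\<Sum>j. s_j / y^j \<ge> 1\<close>; the bound by \<open>\<xi>\<close> thus limits the \<open>s_j\<close>. If \<open>\<alpha>\<close> is not
  monotone, then \<open>(s_1, \<dots>, s_4) \<ge> (1, 1, 3, 4)\<close>, which is too many. If \<open>\<alpha>\<close> is increasing and
  \<open>k \<ge> 7\<close>, then \<open>s_j \<ge> j - 1\<close> for \<open>j \<le> 8\<close>, too many again. So \<open>\<alpha>\<close> is decreasing, and then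
  \<open>s = (1, 1, 3, 3, 1, 1, \<dots>)\<close> is excluded as well. This forces
  \<open>\<pi> = \<sigma> \<oplus> (2k \<dots> 2 1) \<oplus> rc \<sigma>\<close>, of which there are \<open>|C_{n-k}|\<close>.
\<close>

section \<open>Patterns and standardization\<close>

lemma is_perm_iff: "is_perm \<pi> \<longleftrightarrow> distinct \<pi> \<and> (\<forall>x\<in>set \<pi>. 1 \<le> x \<and> x \<le> length \<pi>)"
proof
  assume "distinct \<pi> \<and> (\<forall>x\<in>set \<pi>. 1 \<le> x \<and> x \<le> length \<pi>)"
  moreover from this have "set \<pi> = {1..length \<pi>}"
    by (intro card_subset_eq) (auto simp: distinct_card)
  ultimately show "is_perm \<pi>"
    by (simp add: is_perm_def permutations_of_set_def)
qed (auto simp: is_perm_def permutations_of_set_def)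

lemma is_permD:
  assumes "is_perm \<pi>"
  shows "distinct \<pi>" "set \<pi> = {1..length \<pi>}"
  using assms by (auto simp: is_perm_def permutations_of_set_def)

lemma length_rc [simp]: "length (rc \<pi>) = length \<pi>"
  by (simp add: rc_def)

lemma same_order_append:
  assumes "same_order us us'" "same_order vs vs'"
    and "\<And>u v. u \<in> set us \<Longrightarrow> v \<in> set vs \<Longrightarrow> v < u"
    and "\<And>u v. u \<in> set us' \<Longrightarrow> v \<in> set vs' \<Longrightarrow> v < u"
  shows "same_order (us @ vs) (us' @ vs')"
proof -
  have len: "length us' = length us" "length vs' = length vs"
    using assms(1,2) by (auto simp: same_order_def)
  have "(us @ vs) ! i < (us @ vs) ! j \<longleftrightarrow> (us' @ vs') ! i < (us' @ vs') ! j"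
    if "i < length us + length vs" "j < length us + length vs" for i j
  proof -
    have 1: "v < u" "\<not> u < v" if "u \<in> set us" "v \<in> set vs" for u v
      using assms(3)[OF that] by auto
    have 2: "v < u" "\<not> u < v" if "u \<in> set us'" "v \<in> set vs'" for u v
      using assms(4)[OF that] by auto
    show ?thesis
      using that assms(1,2) len 1 2 by (auto simp: nth_append same_order_def)
  qed
  then show ?thesis
    using len by (auto simp: same_order_def)
qed

lemma same_order_increasing:
  assumes "sorted_wrt (<) xs" "sorted_wrt (<) ys" "length xs = length ys"
  shows "same_order xs ys"
proof -
  have *: "zs ! i < zs ! j \<longleftrightarrow> i < j" if "sorted_wrt (<) zs" "i < length zs" "j < length zs"
    for zs :: "nat list" and i j
    using that sorted_wrt_nth_less[of "(<)" zs i j] sorted_wrt_nth_less[of "(<)" zs j i]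
    by (cases i j rule: linorder_cases) auto
  show ?thesis
    using assms by (simp add: same_order_def *)
qed

lemma same_order_decreasing:
  assumes "sorted_wrt (>) xs" "sorted_wrt (>) ys" "length xs = length ys"
  shows "same_order xs ys"
proof -
  have *: "zs ! i < zs ! j \<longleftrightarrow> j < i" if "sorted_wrt (>) zs" "i < length zs" "j < length zs"
    for zs :: "nat list" and i j
    using that sorted_wrt_nth_less[of "(>)" zs i j] sorted_wrt_nth_less[of "(>)" zs j i]
    by (cases i j rule: linorder_cases) auto
  show ?thesis
    using assms by (simp add: same_order_def *)
qed

text \<open>Turns a failure of monotonicity into a concrete pair of entries.\<close>

lemma sorted_wrt_iff_subseq: "sorted_wrt P xs \<longleftrightarrow> (\<forall>x y. subseq [x, y] xs \<longrightarrow> P x y)"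
proof (induction xs)
  case (Cons a xs)
  have "subseq [x, y] (a # xs) \<longleftrightarrow> (x = a \<and> y \<in> set xs) \<or> subseq [x, y] xs" for x y
    by (auto simp: subseq_Cons2_iff subseq_singleton_left dest: subseq_Cons')
  with Cons show ?case
    by auto
qed auto

definition standardize :: "nat list \<Rightarrow> nat list" where
  "standardize xs = map (\<lambda>x. card {y \<in> set xs. y \<le> x}) xs"

lemma length_standardize [simp]: "length (standardize xs) = length xs"
  by (simp add: standardize_def)

lemma card_le_strict_mono:
  fixes S :: "nat set"
  assumes "finite S" "x \<in> S" "y \<in> S"
  shows "card {z \<in> S. z \<le> x} < card {z \<in> S. z \<le> y} \<longleftrightarrow> x < y"
proof
  assume less: "x < y"
  have "y \<in> {z \<in> S. z \<le> y}" "y \<notin> {z \<in> S. z \<le> x}"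
    using less assms by auto
  then have "{z \<in> S. z \<le> x} \<noteq> {z \<in> S. z \<le> y}" by metis
  then show "card {z \<in> S. z \<le> x} < card {z \<in> S. z \<le> y}"
    by (intro psubset_card_mono psubsetI) (use assms less in auto)
next
  assume *: "card {z \<in> S. z \<le> x} < card {z \<in> S. z \<le> y}"
  show "x < y"
  proof (rule ccontr)
    assume "\<not> x < y"
    then have "card {z \<in> S. z \<le> y} \<le> card {z \<in> S. z \<le> x}"
      using assms by (intro card_mono) auto
    with * show False by simp
  qed
qed

lemma same_order_standardize: "same_order xs (standardize xs)"
  by (simp add: same_order_def standardize_def card_le_strict_mono)

lemma is_perm_standardize:
  assumes "distinct xs"
  shows "is_perm (standardize xs)"
proof -
  have "inj_on (\<lambda>x. card {y \<in> set xs. y \<le> x}) (set xs)"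
  proof (rule inj_onI)
    fix x y
    assume "x \<in> set xs" "y \<in> set xs"
      and "card {z \<in> set xs. z \<le> x} = card {z \<in> set xs. z \<le> y}"
    then show "x = y"
      using card_le_strict_mono[of "set xs" x y] card_le_strict_mono[of "set xs" y x]
      by (cases x y rule: linorder_cases) auto
  qed
  moreover have "card {y \<in> set xs. y \<le> x} \<le> length xs" for x
    by (rule order_trans[OF card_mono[of "set xs"] card_length]) auto
  moreover have "card {y \<in> set xs. y \<le> x} \<ge> 1" if "x \<in> set xs" for x
    using that by (auto simp: Suc_le_eq card_gt_0_iff)
  ultimately show ?thesis
    using assms by (auto simp: is_perm_iff standardize_def distinct_map)
qed

section \<open>Growth rates from sum indecomposables\<close>

text \<open>A permutation splits as a sum after position j exactly when its first j entries are all
  at most j, so one larger entry rules out that cut. Bounded quantifiers let concrete lists be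
  checked by evaluation.\<close>

definition sum_indecomposable :: "nat list \<Rightarrow> bool" where
  "sum_indecomposable a \<longleftrightarrow> a \<noteq> [] \<and> (\<forall>j\<in>{1..<length a}. \<exists>x\<in>set (take j a). j < x)"

text \<open>If \<open>a\<close> were shorter than \<open>b\<close>, it would be a prefix of
  \<open>b\<close> with all entries at most its length, a cut that indecomposability of
  \<open>b\<close> forbids.\<close>

lemma perm_sum_inject:
  assumes "is_perm a" "is_perm b" "sum_indecomposable a" "sum_indecomposable b"
    and eq: "perm_sum a u = perm_sum b v"
  shows "a = b \<and> u = v"
proof -
  have no: False if "is_perm a" "sum_indecomposable a" "sum_indecomposable b"
    "perm_sum a u = perm_sum b v" "length a < length b" for a b u v
  proof -
    have "take (length a) (perm_sum a u) = a"
      by (simp add: perm_sum_def)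
    with that have "take (length a) b = a"
      by (simp add: perm_sum_def)
    moreover have "length a \<in> {1..<length b}"
      using that by (cases a) (auto simp: sum_indecomposable_def)
    ultimately have "\<exists>x\<in>set a. length a < x"
      using that by (metis sum_indecomposable_def)
    with that(1) show False
      by (force simp: is_perm_iff)
  qed
  have "length a = length b"
    using no[of a b u v] no[of b a v u] assms by (metis linorder_neqE_nat)
  with eq show ?thesis
    by (auto simp: perm_sum_def map_inj_on inj_on_def dest!: map_injective)
qed

locale sum_closed_class =
  fixes C :: "nat list set"
  assumes perm_class: "perm_class C" and sum_closed: "sum_closed C"
begin

lemma is_perm: "\<pi> \<in> C \<Longrightarrow> is_perm \<pi>"
  using perm_class by (auto simp: perm_class_def)

lemma pattern_mem:
  assumes "\<pi> \<in> C" "subseq xs \<pi>" "same_order xs \<sigma>" "is_perm \<sigma>"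
  shows "\<sigma> \<in> C"
  using assms perm_class unfolding perm_class_def perm_contains_def by blast

lemma perm_sum_mem: "\<sigma> \<in> C \<Longrightarrow> \<tau> \<in> C \<Longrightarrow> perm_sum \<sigma> \<tau> \<in> C"
  using sum_closed by (simp add: sum_closed_def)

lemma one_mem:
  assumes "\<pi> \<in> C" "\<pi> \<noteq> []"
  shows "[1] \<in> C"
proof (rule pattern_mem[OF assms(1)])
  show "subseq [hd \<pi>] \<pi>"
    using assms(2) by (simp add: subseq_singleton_left)
qed (simp_all add: same_order_def is_perm_iff)

text \<open>Placing a new minimum in front, \<open>perm_sum [1]\<close>, is injective.\<close>

lemma card_of_size_mono:
  assumes "[1] \<in> C" "m \<le> n"
  shows "card (of_size C m) \<le> card (of_size C n)"
  using \<open>m \<le> n\<close>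
proof (induction n rule: dec_induct)
  case (step n)
  have "card (of_size C n) \<le> card (of_size C (Suc n))"
  proof (rule card_inj_on_le)
    show "inj_on (perm_sum [1]) (of_size C n)"
      by (auto simp: inj_on_def perm_sum_def dest!: map_injective)
    show "perm_sum [1] ` of_size C n \<subseteq> of_size C (Suc n)"
      using assms(1) perm_sum_mem by (auto simp: of_size_def) (simp add: perm_sum_def)
  qed (rule finite_of_size[OF perm_class])
  with step show ?case by simp
qed simp

lemma of_size_0:
  assumes "[1] \<in> C"
  shows "of_size C 0 = {[]}"
proof -
  have "[] \<in> C"
    by (rule pattern_mem[OF assms, of "[]"]) (simp_all add: same_order_def is_perm_iff)
  then show ?thesis
    by (auto simp: of_size_def)
qed

lemma card_of_size_pos:
  assumes "[1] \<in> C"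
  shows "1 \<le> card (of_size C n)"
  using card_of_size_mono[OF assms, of 0 n] of_size_0[OF assms] by simp

text \<open>By \<open>perm_sum_inject\<close>, different choices of a first summand from
  \<open>A\<close> and a remainder give different permutations. This is one step of a recurrence for
  the counts.\<close>

lemma card_of_size_ge_sum:
  assumes fin: "finite A" and sub: "A \<subseteq> C" and indec: "\<And>a. a \<in> A \<Longrightarrow> sum_indecomposable a"
    and len: "\<And>a. a \<in> A \<Longrightarrow> length a \<le> n"
  shows "(\<Sum>a\<in>A. card (of_size C (n - length a))) \<le> card (of_size C n)"
proof -
  let ?S = "SIGMA a:A. of_size C (n - length a)"
  have "(\<Sum>a\<in>A. card (of_size C (n - length a))) = card ?S"
    using fin finite_of_size[OF perm_class] by simp
  also have "\<dots> \<le> card (of_size C n)"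
  proof (rule card_inj_on_le)
    show "inj_on (\<lambda>(a, u). perm_sum a u) ?S"
    proof (rule inj_onI, clarify)
      fix a u b v
      assume "a \<in> A" "b \<in> A" "perm_sum a u = perm_sum b v"
      then show "a = b \<and> u = v"
        using sub indec is_perm by (intro perm_sum_inject) auto
    qed
    show "(\<lambda>(a, u). perm_sum a u) ` ?S \<subseteq> of_size C n"
    proof clarify
      fix a u assume "a \<in> A" "u \<in> of_size C (n - length a)"
      then show "perm_sum a u \<in> of_size C n"
        using sub len[of a] perm_sum_mem[of a u] by (auto simp: of_size_def) (simp add: perm_sum_def)
    qed
  qed (rule finite_of_size[OF perm_class])
  finally show ?thesis .
qed

text \<open>By strong induction, the recurrence of \<open>card_of_size_ge_sum\<close> keeps
  \<open>c n * x ^ n\<close> above a positive constant, whose n-th roots tend to 1.\<close>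

lemma growth_rate_ge:
  fixes x :: real
  assumes lim: "(\<lambda>n. root n (real (card (of_size C n)))) \<longlonglongrightarrow> L"
    and "distinct as" "set as \<subseteq> C" "\<forall>a\<in>set as. sum_indecomposable a"
    and x: "0 < x" and sum: "1 \<le> (\<Sum>a\<leftarrow>as. x ^ length a)"
  shows "1 / x \<le> L"
proof -
  define c where "c n = real (card (of_size C n))" for n
  define J where "J = Max (length ` set as)"
  have "as \<noteq> []"
    using sum by auto
  then obtain a where a: "a \<in> set as" by (cases as) auto
  with assms have one: "[1] \<in> C"
    using one_mem[of a] by (auto simp: sum_indecomposable_def)
  have len: "length a \<le> J" if "a \<in> set as" for a
    using that by (auto simp: J_def)
  \<comment> \<open>Since \<open>c n\<close> is at least 1, this constant covers the starting values
    n \<le> J of the induction.\<close>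
  define e where "e = min 1 (x ^ J)"
  have e: "0 < e" "e \<le> 1" using x by (auto simp: e_def)
  have e': "e \<le> x ^ n" if "n \<le> J" for n
  proof (cases "x \<le> 1")
    case True
    then have "x ^ J \<le> x ^ n" using that x by (intro power_decreasing) auto
    then show ?thesis by (simp add: e_def)
  next
    case False
    then have "1 \<le> x ^ n" by simp
    then show ?thesis using e by simp
  qed
  have lower: "e \<le> c n * x ^ n" for n
  proof (induction n rule: less_induct)
    case (less n)
    show ?case
    proof (cases "n \<le> J")
      case True
      have "1 * x ^ n \<le> c n * x ^ n"
        using card_of_size_pos[OF one, of n] x by (intro mult_right_mono) (auto simp: c_def)
      with e'[OF True] show ?thesis by simp
    next
      case False
      \<comment> \<open>Weights of total at least 1 pass the bound \<open>e\<close> from the smaller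
        sizes to n.\<close>
      have "e * 1 \<le> e * (\<Sum>a\<in>set as. x ^ length a)"
        using sum e assms(2) by (intro mult_left_mono) (auto simp: sum_list_distinct_conv_sum_set)
      also have "\<dots> = (\<Sum>a\<in>set as. e * x ^ length a)"
        by (simp add: sum_distrib_left)
      also have "\<dots> \<le> (\<Sum>a\<in>set as. c (n - length a) * x ^ n)"
      proof (rule sum_mono)
        fix a assume a: "a \<in> set as"
        then have "length a > 0" "length a \<le> n" "n - length a < n"
          using assms(4) len[OF a] False by (auto simp: sum_indecomposable_def)
        then have "e * x ^ length a \<le> (c (n - length a) * x ^ (n - length a)) * x ^ length a"
          using less[of "n - length a"] x by (intro mult_right_mono) auto
        also have "\<dots> = c (n - length a) * x ^ n"
          using \<open>length a \<le> n\<close> by (simp add: mult.assoc flip: power_add)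
        finally show "e * x ^ length a \<le> c (n - length a) * x ^ n" .
      qed
      also have "\<dots> = real (\<Sum>a\<in>set as. card (of_size C (n - length a))) * x ^ n"
        by (simp add: c_def sum_distrib_right)
      also have "\<dots> \<le> c n * x ^ n"
        unfolding c_def using assms len False x
        by (intro mult_right_mono of_nat_mono card_of_size_ge_sum)
          (auto intro: order_trans[of _ J])
      finally show ?thesis by simp
    qed
  qed
  have "(\<lambda>n. root n e * (1 / x)) \<longlonglongrightarrow> 1 * (1 / x)"
    by (intro tendsto_intros LIMSEQ_root_const e)
  moreover have "eventually (\<lambda>n. root n e * (1 / x) \<le> root n (c n)) sequentially"
    using eventually_gt_at_top[of 0]
  proof eventually_elim
    case (elim n)
    have "root n e \<le> root n (c n * x ^ n)"
      using lower elim by simp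
    also have "\<dots> = root n (c n) * x"
      using elim x by (simp add: real_root_mult real_root_power_cancel)
    finally show ?case
      using x by (simp add: field_simps)
  qed
  ultimately show ?thesis
    using lim by (auto intro: tendsto_le[OF sequentially_bot] simp: c_def)
qed

end

lemma subseq_pair_cases:
  assumes "x \<in> set xs" "y \<in> set xs" "x \<noteq> y"
  shows "subseq [x, y] xs \<or> subseq [y, x] xs"
  using assms by (induction xs) (auto simp: subseq_singleton_left)

lemma distinct_iff_sorted_wrt_neq: "distinct xs \<longleftrightarrow> sorted_wrt (\<noteq>) xs"
  by (induction xs) auto

lemma set_mono_subseq: "subseq xs ys \<Longrightarrow> set xs \<subseteq> set ys"
  by (induction rule: list_emb.induct) auto

lemma sum_list_map_concat:
  "sum_list (map f (concat xss)) = (\<Sum>xs\<leftarrow>xss. sum_list (map f xs))"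
  by (induction xss) auto

text \<open>The four patterns that long decreasing permutations exclude from a small class, see
  \<open>decreasing_excludes\<close>.\<close>

lemma same_order_4:
  fixes a b c d :: nat
  shows same_order_4132: "b < d \<Longrightarrow> d < c \<Longrightarrow> c < a \<Longrightarrow> same_order [a, b, c, d] [4, 1, 3, 2]"
    and same_order_2431: "d < a \<Longrightarrow> a < c \<Longrightarrow> c < b \<Longrightarrow> same_order [a, b, c, d] [2, 4, 3, 1]"
    and same_order_3421: "d < c \<Longrightarrow> c < a \<Longrightarrow> a < b \<Longrightarrow> same_order [a, b, c, d] [3, 4, 2, 1]"
    and same_order_4312: "c < d \<Longrightarrow> d < b \<Longrightarrow> b < a \<Longrightarrow> same_order [a, b, c, d] [4, 3, 1, 2]"
  by (simp_all add: same_order_def All_less_Suc)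

lemma append_filters:
  assumes "sorted_wrt (\<lambda>a b. Q b \<longrightarrow> Q a) xs"
  shows "filter Q xs @ filter (\<lambda>x. \<not> Q x) xs = xs"
  using assms
proof (induction xs)
  case (Cons a xs)
  show ?case
  proof (cases "Q a")
    case False
    then have "filter Q xs = []" "filter (\<lambda>x. \<not> Q x) xs = xs"
      using Cons.prems by (auto simp: filter_empty_conv filter_id_conv)
    with False show ?thesis by simp
  qed (use Cons in simp)
qed simp

text \<open>No element of T lies below \<open>Max S\<close>, so everything from 1 to
  \<open>Max S\<close> belongs to S.\<close>

lemma initial_segment:
  fixes S T :: "nat set"
  assumes un: "S \<union> T = {1..n}" and less: "\<And>p v. p \<in> S \<Longrightarrow> v \<in> T \<Longrightarrow> p < v"
  shows "S = {1..n - card T}"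
proof -
  have fin: "finite S" "finite T"
    using un by (metis finite_Un finite_atLeastAtMost)+
  have "S \<inter> T = {}" using less by fastforce
  then have card: "card S + card T = n"
    using card_Un_disjoint[OF fin] un by simp
  have "S = {1..card S}"
  proof (cases "S = {}")
    case False
    have "{1..Max S} \<subseteq> S"
    proof
      fix x assume "x \<in> {1..Max S}"
      moreover have "Max S \<in> S" using False fin by simp
      moreover from this have "Max S \<in> {1..n}" using un by blast
      ultimately have "x \<in> S \<union> T" "x \<notin> T"
        using un less[of "Max S" x] by auto
      then show "x \<in> S" by simp
    qed
    moreover have "S \<subseteq> {1..Max S}" using un fin by auto
    ultimately have "S = {1..Max S}" by blast
    then show ?thesis by (metis card_atLeastAtMost diff_Suc_1)
  qed simp
  with card show ?thesis by (metis diff_add_inverse2)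
qed

section \<open>The quadrants of a centrosymmetric permutation\<close>

locale centrosymmetric_perm =
  fixes \<pi> :: "nat list" and n :: nat
  assumes perm: "is_perm \<pi>" and len: "length \<pi> = 2 * n" and centrosym: "centrosymmetric \<pi>"
begin

text \<open>
  \<open>us\<close> and \<open>vs\<close> list the values in the upper left and the lower right quadrant.
\<close>

definition xs where "xs = take n \<pi>"
definition ys where "ys = drop n \<pi>"
definition us where "us = filter (\<lambda>v. n < v) xs"
definition vs where "vs = filter (\<lambda>v. v \<le> n) ys"

lemma append_halves: "xs @ ys = \<pi>"
  by (simp add: xs_def ys_def)

lemma length_xs: "length xs = n"
  using len by (simp add: xs_def)

lemma distinct_halves: "distinct xs" "distinct ys" "set xs \<inter> set ys = {}"
proof -
  have "distinct (xs @ ys)"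
    using is_permD(1)[OF perm] by (simp only: append_halves)
  then show "distinct xs" "distinct ys" "set xs \<inter> set ys = {}"
    by auto
qed

lemma set_halves: "set xs \<union> set ys = {1..2 * n}"
  using is_permD(2)[OF perm] unfolding set_append[symmetric] append_halves len .

lemma ys_eq: "ys = map (\<lambda>v. 2 * n + 1 - v) (rev xs)"
proof -
  have "\<pi> = map (\<lambda>v. 2 * n + 1 - v) (rev \<pi>)"
    using centrosym unfolding centrosymmetric_def rc_def len by (rule sym)
  also have "rev \<pi> = rev ys @ rev xs"
    using arg_cong[OF append_halves, of rev] by simp
  finally have "xs @ ys = map (\<lambda>v. 2 * n + 1 - v) (rev ys) @ map (\<lambda>v. 2 * n + 1 - v) (rev xs)"
    unfolding append_halves map_append .
  moreover have "length xs = length (map (\<lambda>v. 2 * n + 1 - v) (rev ys))"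
    using len by (simp add: xs_def ys_def)
  ultimately show ?thesis
    using append_eq_append_conv by blast
qed

lemma in_xs: "v \<in> set xs \<Longrightarrow> 1 \<le> v \<and> v \<le> 2 * n"
proof -
  assume "v \<in> set xs"
  then have "v \<in> {1..2 * n}"
    unfolding set_halves[symmetric] ..
  then show ?thesis by simp
qed

text \<open>The half-turn fixing \<pi> exchanges the upper left and lower right quadrants.\<close>

lemma vs_eq: "vs = map (\<lambda>v. 2 * n + 1 - v) (rev us)"
proof -
  have "filter ((\<lambda>v. v \<le> n) \<circ> (\<lambda>v. 2 * n + 1 - v)) (rev xs) = filter (\<lambda>v. n < v) (rev xs)"
    using in_xs by (intro filter_cong) auto
  then show ?thesis
    by (simp add: vs_def us_def ys_eq filter_map rev_filter)
qed

lemma in_us: "u \<in> set us \<Longrightarrow> n < u \<and> u \<le> 2 * n"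
  using in_xs by (auto simp: us_def)

lemma vs_less_us: "v \<in> set vs \<Longrightarrow> u \<in> set us \<Longrightarrow> v < u"
  by (auto simp: us_def vs_def)

lemma distinct_us: "distinct us"
  using distinct_halves by (simp add: us_def)

lemma subseq_halves: "subseq ps xs \<Longrightarrow> subseq qs ys \<Longrightarrow> subseq (ps @ qs) \<pi>"
  using list_emb_append_mono[of "(=)" ps xs qs ys] by (simp only: append_halves)

lemma subseq_us_vs:
  assumes "subseq ps us" "subseq qs vs"
  shows "subseq (ps @ qs) \<pi>"
proof -
  have "subseq ps xs" "subseq qs ys"
    using assms subseq_order.trans[OF _ subseq_filter_left] by (auto simp: us_def vs_def)
  then show ?thesis
    by (rule subseq_halves)
qed

lemma sorted_wrt_vs:
  "sorted_wrt R vs \<longleftrightarrow> sorted_wrt (\<lambda>a b. R (2 * n + 1 - b) (2 * n + 1 - a)) us"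
  unfolding vs_eq sorted_wrt_map sorted_wrt_rev ..

text \<open>A half-turn reverses both positions and values, so it preserves the direction of a
  monotone sequence.\<close>

lemma sorted_vs:
  shows "sorted_wrt (<) us \<Longrightarrow> sorted_wrt (<) vs" and "sorted_wrt (>) us \<Longrightarrow> sorted_wrt (>) vs"
proof -
  have *: "2 * n + 1 - b < 2 * n + 1 - a" if "a \<in> set us" "b \<in> set us" "a < b" for a b
    using in_us[OF that(2)] that(3) by linarith
  show "sorted_wrt (<) us \<Longrightarrow> sorted_wrt (<) vs"
    unfolding sorted_wrt_vs by (erule sorted_wrt_mono_rel[rotated]) (rule *)
  show "sorted_wrt (>) us \<Longrightarrow> sorted_wrt (>) vs"
    unfolding sorted_wrt_vs by (erule sorted_wrt_mono_rel[rotated]) (rule *)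
qed

lemma subseq_vs:
  assumes "subseq [x, y] us"
  shows "subseq [2 * n + 1 - y, 2 * n + 1 - x] vs"
proof -
  obtain A E where "us = A @ x # E" "y \<in> set E"
    using list_emb_ConsD[OF assms] by (auto simp: subseq_singleton_left)
  moreover from this obtain B D where "E = B @ y # D"
    by (meson split_list)
  ultimately have "us = A @ x # B @ y # D"
    by simp
  then have "vs = map (\<lambda>v. 2 * n + 1 - v) (rev D) @ (2 * n + 1 - y) #
      map (\<lambda>v. 2 * n + 1 - v) (rev B) @ (2 * n + 1 - x) # map (\<lambda>v. 2 * n + 1 - v) (rev A)"
    by (simp add: vs_eq)
  moreover have "subseq [a, b] (P @ a # Q @ b # R)" for a b :: nat and P Q R
    by (rule subseq_drop_many) (simp add: subseq_singleton_left)
  ultimately show ?thesis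
    by metis
qed

text \<open>A value up to n sits in the left half or, failing that, in \<open>vs\<close>. The
  absence of gaps is what makes \<open>standardize\<close> fix these values later.\<close>

lemma low_values: "{v \<in> set (xs @ vs). v \<le> n} = {1..n}"
proof -
  have "{v \<in> set (xs @ vs). v \<le> n} = {v \<in> set xs \<union> set ys. v \<le> n}"
    by (auto simp: vs_def)
  also have "\<dots> = {1..n}"
    unfolding set_halves by auto
  finally show ?thesis .
qed

end

section \<open>Classes of growth rate at most \<open>\<xi>\<close>\<close>

locale small_class = sum_closed_class +
  fixes L :: real
  assumes rc_invariant: "rc_invariant C"
    and lim: "(\<lambda>n. root n (real (card (of_size C n)))) \<longlonglongrightarrow> L"
    and L_le: "L \<le> xi"
begin

lemma rc_mem: "\<sigma> \<in> C \<Longrightarrow> rc \<sigma> \<in> C"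
  using rc_invariant by (auto simp: rc_invariant_def)

text \<open>
  2.3053 is just above \<open>\<xi>\<close>; the sequence \<open>1, 1, 3, 3, 1, 1, \<dots>\<close> leaves very little room here.
\<close>

lemma indecomposable_weight_less:
  assumes "distinct as" "set as \<subseteq> C" "\<forall>a\<in>set as. sum_indecomposable a"
  shows "(\<Sum>a\<leftarrow>as. (10000 / 23053 :: real) ^ length a) < 1"
proof (rule ccontr)
  assume "\<not> ?thesis"
  then have "1 / (10000 / 23053) \<le> L"
    using assms by (intro growth_rate_ge[OF lim]) auto
  with L_le xi_bounds show False by simp
qed

lemma rc_231_iff: "[2, 3, 1] \<in> C \<longleftrightarrow> [3, 1, 2] \<in> C"
  using rc_mem[of "[2, 3, 1]"] rc_mem[of "[3, 1, 2]"] by (auto simp: rc_def numeral_eq_Suc)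

text \<open>With 231, 312, \<sigma> and its distinct image \<open>rc \<sigma>\<close>, the
  decreasing permutations give 1, 1, 3, 3, 1, ..., 1 indecomposables of sizes 1 to 14, whose weight
  reaches 1. Size 14 will come from two decreasing runs of length 7.\<close>

lemma decreasing_excludes:
  assumes dec: "\<And>j. j \<le> 14 \<Longrightarrow> rev [1..<Suc j] \<in> C"
    and \<sigma>: "\<sigma> \<in> {[4, 1, 3, 2], [2, 4, 3, 1], [3, 4, 2, 1], [4, 3, 1, 2]}"
  shows "\<sigma> \<notin> C"
proof
  assume "\<sigma> \<in> C"
  \<comment> \<open>Each of the four patterns contains 231 or 312; invariance under
    \<open>rc\<close> supplies the other one.\<close>
  have sub: "[2, 3, 1] \<in> C \<or> [3, 1, 2] \<in> C"
    using \<sigma>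
  proof (elim insertE emptyE)
    assume "\<sigma> = [4, 1, 3, 2]"
    then have "[3, 1, 2] \<in> C"
      by (intro pattern_mem[OF \<open>\<sigma> \<in> C\<close>, of "[4, 1, 3]"])
        (simp_all add: is_perm_iff same_order_def All_less_Suc)
    then show ?thesis ..
  next
    assume "\<sigma> = [2, 4, 3, 1]"
    then have "[2, 3, 1] \<in> C"
      by (intro pattern_mem[OF \<open>\<sigma> \<in> C\<close>, of "[2, 4, 1]"])
        (simp_all add: is_perm_iff same_order_def All_less_Suc)
    then show ?thesis ..
  next
    assume "\<sigma> = [3, 4, 2, 1]"
    then have "[2, 3, 1] \<in> C"
      by (intro pattern_mem[OF \<open>\<sigma> \<in> C\<close>, of "[3, 4, 2]"])
        (simp_all add: is_perm_iff same_order_def All_less_Suc)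
    then show ?thesis ..
  next
    assume "\<sigma> = [4, 3, 1, 2]"
    then have "[3, 1, 2] \<in> C"
      by (intro pattern_mem[OF \<open>\<sigma> \<in> C\<close>, of "[4, 1, 2]"])
        (simp_all add: is_perm_iff same_order_def All_less_Suc)
    then show ?thesis ..
  qed
  define as where "as = [2, 3, 1] # [3, 1, 2] # \<sigma> # rc \<sigma> # map (\<lambda>j. rev [1..<Suc j]) [1..<15]"
  have "\<forall>\<sigma>\<in>{[4, 1, 3, 2], [2, 4, 3, 1], [3, 4, 2, 1], [4, 3, 1, 2]}.
    let as = [2, 3, 1] # [3, 1, 2] # \<sigma> # rc \<sigma> # map (\<lambda>j. rev [1..<Suc j]) [1..<15]
    in distinct as \<and> (\<forall>a\<in>set as. sum_indecomposable a)"
    by code_simp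
  then have "distinct as" "\<forall>a\<in>set as. sum_indecomposable a"
    using \<sigma> unfolding as_def Let_def by blast+
  moreover have "set as \<subseteq> C"
    using sub rc_231_iff \<open>\<sigma> \<in> C\<close> rc_mem[OF \<open>\<sigma> \<in> C\<close>] dec by (auto simp: as_def simp del: upt_Suc)
  ultimately have "(\<Sum>a\<leftarrow>as. (10000 / 23053 :: real) ^ length a) < 1"
    by (intro indecomposable_weight_less)
  moreover have "length \<sigma> = 4" using \<sigma> by auto
  then have "(\<Sum>a\<leftarrow>as. (10000 / 23053 :: real) ^ length a) =
      2 * (10000 / 23053) ^ 3 + 2 * (10000 / 23053) ^ 4 + (\<Sum>j\<leftarrow>[1..<15]. (10000 / 23053) ^ j)"
    by (simp add: as_def o_def numeral_3_eq_3 del: upt_Suc)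
  ultimately show False
    by (simp add: upt_conv_Cons power_divide)
qed

end

section \<open>The upper left quadrant in a small class\<close>

locale small_class_centrosymmetric = small_class + centrosymmetric_perm +
  assumes mem: "\<pi> \<in> C"
begin

lemma us_vs_pattern_mem:
  assumes "subseq ps us" "subseq qs vs" "same_order (ps @ qs) \<sigma>" "is_perm \<sigma>"
  shows "\<sigma> \<in> C"
  using pattern_mem[OF mem subseq_us_vs] assms by blast

text \<open>A descending and an ascending pair of \<open>us\<close> can each be followed by the
  mirror image of either in \<open>vs\<close>. The four skew sums and smaller patterns have weight
  at least 1.\<close>

lemma us_monotone: "sorted_wrt (<) us \<or> sorted_wrt (>) us"
proof (rule ccontr)
  assume neither: "\<not> ?thesis"
  have ne: "x \<noteq> y" if "subseq [x, y] us" for x y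
    using that distinct_us sorted_wrt_iff_subseq[of "(\<noteq>)" us]
    by (simp add: distinct_iff_sorted_wrt_neq)
  obtain a b where ab: "subseq [a, b] us" "b < a"
    using neither ne by (metis sorted_wrt_iff_subseq linorder_neqE_nat)
  obtain c d where cd: "subseq [c, d] us" "c < d"
    using neither ne by (metis sorted_wrt_iff_subseq linorder_neqE_nat)
  \<comment> \<open>Mirror images under the half-turn: \<open>b'\<close> precedes \<open>a'\<close>
    and is the larger of the two.\<close>
  define a' b' c' d' where defs: "a' = 2 * n + 1 - a" "b' = 2 * n + 1 - b"
    "c' = 2 * n + 1 - c" "d' = 2 * n + 1 - d"
  have vs: "subseq [b', a'] vs" "subseq [d', c'] vs"
    using subseq_vs[OF ab(1)] subseq_vs[OF cd(1)] by (simp_all add: defs)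
  have sub1: "subseq [a] us" "subseq [b'] vs"
    using set_mono_subseq[OF ab(1)] set_mono_subseq[OF vs(1)] by (auto simp: subseq_singleton_left)
  have abcd: "a \<in> set us" "b \<in> set us" "c \<in> set us" "d \<in> set us"
    using set_mono_subseq[OF ab(1)] set_mono_subseq[OF cd(1)] by auto
  moreover have "a' \<in> set vs" "b' \<in> set vs" "c' \<in> set vs" "d' \<in> set vs"
    using set_mono_subseq[OF vs(1)] set_mono_subseq[OF vs(2)] by auto
  ultimately have less: "\<forall>x\<in>{a', b', c', d'}. \<forall>y\<in>{a, b, c, d}. x < y"
    using vs_less_us by blast
  have less': "a' < b'" "d' < c'"
    using ab(2) cd(2) abcd[THEN in_us] by (auto simp: defs)
  note simps = same_order_def All_less_Suc is_perm_iff
  have "[2, 1] \<in> C"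
    by (rule us_vs_pattern_mem[OF sub1]) (use less in \<open>simp_all add: simps\<close>)
  moreover have "[1] \<in> C"
    by (rule one_mem[OF calculation]) simp
  moreover have "[3, 2, 1] \<in> C"
    by (rule us_vs_pattern_mem[OF ab(1) sub1(2)]) (use less ab in \<open>simp_all add: simps\<close>)
  moreover have "[2, 3, 1] \<in> C"
    by (rule us_vs_pattern_mem[OF cd(1) sub1(2)]) (use less cd in \<open>simp_all add: simps\<close>)
  moreover have "[4, 3, 2, 1] \<in> C"
    by (rule us_vs_pattern_mem[OF ab(1) vs(1)]) (use less less' ab in \<open>simp_all add: simps\<close>)
  moreover have "[4, 3, 1, 2] \<in> C"
    by (rule us_vs_pattern_mem[OF ab(1) vs(2)]) (use less less' ab in \<open>simp_all add: simps\<close>)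
  moreover have "[3, 4, 2, 1] \<in> C"
    by (rule us_vs_pattern_mem[OF cd(1) vs(1)]) (use less less' cd in \<open>simp_all add: simps\<close>)
  moreover have "[3, 4, 1, 2] \<in> C"
    by (rule us_vs_pattern_mem[OF cd(1) vs(2)]) (use less less' cd in \<open>simp_all add: simps\<close>)
  moreover define as :: "nat list list" where "as = [[1], [2, 1], [3, 2, 1], [2, 3, 1], [3, 1, 2],
    [4, 3, 2, 1], [4, 3, 1, 2], [3, 4, 2, 1], [3, 4, 1, 2]]"
  ultimately have "set as \<subseteq> C"
    using rc_231_iff by (simp add: as_def)
  moreover have "distinct as" "\<forall>a\<in>set as. sum_indecomposable a"
    unfolding as_def by code_simp+
  ultimately have "(\<Sum>a\<leftarrow>as. (10000 / 23053 :: real) ^ length a) < 1"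
    by (intro indecomposable_weight_less)
  then show False
    by (simp add: as_def power_divide)
qed

text \<open>Initial runs of \<open>us\<close> and \<open>vs\<close> of lengths a and b form the skew
  sum of two increasing permutations, which gives j - 1 indecomposables for each size j from 2 to
  8.\<close>

lemma increasing_us_short:
  assumes "sorted_wrt (<) us"
  shows "length us < 7"
proof (rule ccontr)
  assume len: "\<not> length us < 7"
  define skew :: "nat \<Rightarrow> nat \<Rightarrow> nat list" where "skew a b = [b + 1..<b + a + 1] @ [1..<b + 1]" for a b
  have skew: "skew a b \<in> C" if "a \<le> 7" "b \<le> 7" for a b
  proof (rule us_vs_pattern_mem)
    show "subseq (take a us) us" "subseq (take b vs) vs"
      by (simp_all add: prefix_imp_subseq take_is_prefix)
    have lens: "length (take a us) = a" "length (take b vs) = b"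
      using that len by (simp_all add: vs_eq)
    show "same_order (take a us @ take b vs) (skew a b)"
      unfolding skew_def
    proof (rule same_order_append)
      show "same_order (take a us) [b + 1..<b + a + 1]" "same_order (take b vs) [1..<b + 1]"
        using assms sorted_vs(1) lens
        by (auto intro!: same_order_increasing sorted_wrt_take simp del: upt_Suc)
    qed (auto dest!: in_set_takeD intro: vs_less_us)
    show "is_perm (skew a b)"
      by (auto simp: skew_def is_perm_iff)
  qed
  \<comment> \<open>The ranges list all positive a, b with a + b \<le> 8, so no run exceeds
    7.\<close>
  define as where "as = [1] # concat (map (\<lambda>a. map (skew a) [1..<9 - a]) [1..<8])"
  have "[1] \<in> C"
    using one_mem[OF skew[of 1 1]] by (simp add: skew_def)
  then have "set as \<subseteq> C"
    using skew by (auto simp: as_def)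
  moreover have "distinct as" "\<forall>a\<in>set as. sum_indecomposable a"
    unfolding as_def skew_def by code_simp+
  ultimately have "(\<Sum>a\<leftarrow>as. (10000 / 23053 :: real) ^ length a) < 1"
    by (intro indecomposable_weight_less)
  moreover have "(\<Sum>a\<leftarrow>as. (10000 / 23053 :: real) ^ length a) =
      10000 / 23053 + (\<Sum>a\<leftarrow>[1..<8]. \<Sum>b\<leftarrow>[1..<9 - a]. (10000 / 23053) ^ (a + b))"
    by (simp add: as_def skew_def o_def sum_list_map_concat del: upt_Suc)
  ultimately show False
    by (simp add: upt_conv_Cons power_divide)
qed

text \<open>A decreasing run of length 14 excludes four patterns of size 4. A low entry of the left
  half that follows an entry of \<open>us\<close> or exceeds one of \<open>vs\<close> would create
  one of them.\<close>

lemma decreasing_us_structure: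
  assumes dec: "sorted_wrt (>) us" and len_us: "7 \<le> length us"
  shows "\<exists>\<sigma>. xs = \<sigma> @ rev [Suc n..<Suc (n + length us)] \<and> set \<sigma> = {1..n - length us}"
proof -
  have excluded: "\<sigma> \<notin> C" if "\<sigma> \<in> {[4, 1, 3, 2], [2, 4, 3, 1], [3, 4, 2, 1], [4, 3, 1, 2]}" for \<sigma>
  proof (rule decreasing_excludes[OF _ that])
    fix j :: nat assume "j \<le> 14"
    \<comment> \<open>\<open>us @ vs\<close> is decreasing of length at least 14, so its prefixes
      supply every size up to 14.\<close>
    have "subseq (us @ vs) \<pi>"
      by (rule subseq_us_vs) simp_all
    then have "subseq (take j (us @ vs)) \<pi>"
      by (rule subseq_order.trans[OF prefix_imp_subseq[OF take_is_prefix]])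
    then show "rev [1..<Suc j] \<in> C"
    proof (rule pattern_mem[OF mem])
      have "sorted_wrt (>) (us @ vs)"
        using dec sorted_vs(2) vs_less_us by (auto simp: sorted_wrt_append)
      then show "same_order (take j (us @ vs)) (rev [1..<Suc j])"
        using len_us \<open>j \<le> 14\<close>
        by (intro same_order_decreasing sorted_wrt_take)
          (auto simp: sorted_wrt_rev vs_eq simp del: upt_Suc)
      show "is_perm (rev [1..<Suc j])"
        by (auto simp: is_perm_iff simp del: upt_Suc)
    qed
  qed
  have no_pattern: False if "subseq ps xs" "subseq qs ys" "same_order (ps @ qs) \<sigma>"
    "\<sigma> \<in> {[4, 1, 3, 2], [2, 4, 3, 1], [3, 4, 2, 1], [4, 3, 1, 2]}" for ps qs \<sigma>
  proof -
    have "subseq (ps @ qs) \<pi>"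
      using that(1,2) by (rule subseq_halves)
    moreover have "is_perm \<sigma>"
      using that(4) by (auto simp: is_perm_iff)
    ultimately show False
      using pattern_mem[OF mem] that(3) excluded[OF that(4)] by blast
  qed
  have subseq_singleton_ys: "subseq [v] ys" if "v \<in> set vs" for v
    using that by (simp add: vs_def subseq_singleton_left)
  obtain u1 u2 us' where us: "us = u1 # u2 # us'" 
    using len_us by (auto simp: numeral_eq_Suc Suc_le_length_iff)
  then have u12: "u2 < u1" using dec by simp
  define v1 v2 where v12_def: "v1 = 2 * n + 1 - u2" "v2 = 2 * n + 1 - u1"
  have v12: "v2 < v1" using u12 in_us[of u1] us by (auto simp: v12_def)
  have "subseq [v1, v2] vs"
    unfolding v12_def by (rule subseq_vs) (simp add: us)
  moreover have vs_ys: "subseq vs ys"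
    by (simp add: vs_def)
  ultimately have v12_ys: "subseq [v1, v2] ys" "v1 \<in> set vs" "v2 \<in> set vs"
    using subseq_order.trans set_mono_subseq[of "[v1, v2]" vs] by auto
  \<comment> \<open>Between two entries of \<open>us\<close>, the low entry p creates 4132 or 3421;
    after all of them, 4312. Before them, lying above both \<open>v1\<close> and \<open>v2\<close>
    gives 3421, and lying between two values of \<open>vs\<close> gives 2431.\<close>
  have low: "(\<forall>u\<in>set us. u \<in> set B) \<and> (\<forall>v\<in>set vs. p < v)"
    if split: "xs = A @ p # B" and p: "p \<le> n" for A p B
  proof -
    have p_less: "p < u" if "u \<in> set us" for u
      using in_us[OF that] p by simp
    have p_notin: "p \<notin> set vs"
      using distinct_halves(3) split by (auto simp: vs_def)
    have us_split: "us = filter (\<lambda>v. n < v) A @ filter (\<lambda>v. n < v) B"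
      using p by (simp add: us_def split)
    have below: False if "u \<in> set us" "u \<in> set B" "v1 < p" "v2 < p" for u
    proof (rule no_pattern[of "[p, u]" "[v1, v2]" "[3, 4, 2, 1]"])
      show "subseq [p, u] xs"
        using that by (simp add: split subseq_singleton_left subseq_drop_many)
      show "same_order ([p, u] @ [v1, v2]) [3, 4, 2, 1]"
        using that p_less v12 by (simp add: same_order_3421 del: One_nat_def)
    qed (use v12_ys in simp_all)
    have not_both: False if u: "u \<in> set us" "u \<in> set A" and u': "u' \<in> set us" "u' \<in> set B" for u u'
    proof -
      have sub: "subseq [u, p, u'] xs"
        using list_emb_append_mono[of "(=)" "[u]" A "[p, u']" "p # B"] u u'
        by (simp add: split subseq_singleton_left)
      have "subseq [u, u'] us"
        using list_emb_append_mono[of "(=)" "[u]" "filter (\<lambda>v. n < v) A" "[u']" "filter (\<lambda>v. n < v) B"]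
          u(2) u'(2) in_us[OF u(1)] in_us[OF u'(1)]
        by (simp add: us_split subseq_singleton_left)
      then have "u' < u"
        using dec by (auto simp: sorted_wrt_iff_subseq)
      have "v < p" if v: "v \<in> set vs" for v
      proof (rule ccontr)
        assume "\<not> v < p"
        then have "p < v" using p_notin v by (cases p v rule: linorder_cases) auto
        show False
          using no_pattern[OF sub subseq_singleton_ys[OF v], of "[4, 1, 3, 2]"] \<open>p < v\<close> \<open>u' < u\<close> vs_less_us[OF v u'(1)]
          by (simp add: same_order_4132 del: One_nat_def)
      qed
      then show False
        using below[of u'] u' v12_ys by blast
    qed
    have B: "\<exists>u\<in>set us. u \<in> set B"
    proof (rule ccontr)
      assume none: "\<not> ?thesis"
      have "u \<in> set us" if "u \<in> set B" "n < u" for u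
        using that by (simp add: us_split)
      with none have "\<forall>u\<in>set B. \<not> n < u"
        by blast
      then have "filter (\<lambda>v. n < v) B = []"
        by (simp only: filter_empty_conv)
      then have "subseq us A"
        by (simp add: us_split)
      moreover have "subseq [u1, u2] us"
        by (simp add: us)
      ultimately have "subseq [u1, u2] A"
        by (rule subseq_order.trans[rotated])
      then have sub: "subseq [u1, u2, p] xs"
        using list_emb_append_mono[of "(=)" "[u1, u2]" A "[p]" "p # B"] by (simp add: split)
      have u: "u1 \<in> set us" "u2 \<in> set us" using us by auto
      have vp: "v < p" if v: "v \<in> set vs" for v
      proof (rule ccontr)
        assume "\<not> v < p"
        then have "p < v" using p_notin v by (cases p v rule: linorder_cases) auto
        show False
          using no_pattern[OF sub subseq_singleton_ys[OF v], of "[4, 3, 1, 2]"] \<open>p < v\<close> u12 vs_less_us[OF v u(2)]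
          by (simp add: same_order_4312 del: One_nat_def)
      qed
      \<comment> \<open>\<open>p\<close> lies in the middle of the decreasing block; its mirror image \<open>q\<close> forms an ascent with it\<close>
      define q where "q = 2 * n + 1 - p"
      have "q \<in> set ys"
        by (simp add: ys_eq q_def split)
      moreover have "q < u1" "q < u2" "p < q"
        using vp[OF v12_ys(2)] vp[OF v12_ys(3)] p u[THEN in_us] by (auto simp: v12_def q_def)
      ultimately show False
        using no_pattern[OF sub, of "[q]" "[4, 3, 1, 2]"] u12
        by (simp add: same_order_4312 subseq_singleton_left del: One_nat_def)
    qed
    then obtain u where u: "u \<in> set us" "u \<in> set B" by blast
    have "u' \<in> set B" if "u' \<in> set us" for u'
    proof -
      have "u' \<in> set A \<or> u' \<in> set B"
        using that unfolding us_split by auto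
      then show ?thesis
        using not_both[OF that _ u] by blast
    qed
    moreover have "p < v" if v: "v \<in> set vs" for v
    proof (rule ccontr)
      assume "\<not> p < v"
      then have "v < p" using p_notin v by (cases p v rule: linorder_cases) auto
      have sub: "subseq [p, u] xs"
        using u by (simp add: split subseq_singleton_left subseq_drop_many)
      obtain w where w: "w \<in> set vs" "p < w"
      proof -
        have "v1 \<noteq> p" "v2 \<noteq> p"
          using v12_ys p_notin by auto
        then have "p < v1 \<or> p < v2"
          using below[OF u] by (meson linorder_neqE_nat)
        then show thesis
          using v12_ys that by blast
      qed
      have ne: "w \<noteq> v" using \<open>v < p\<close> \<open>p < w\<close> by simp
      have "subseq [w, v] vs"
      proof -
        have "\<not> subseq [v, w] vs"
          using sorted_vs(2)[OF dec] \<open>v < p\<close> \<open>p < w\<close> unfolding sorted_wrt_iff_subseq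
          by (metis less_trans less_asym)
        then show ?thesis
          using subseq_pair_cases[OF w(1) v ne] by blast
      qed
      then have "subseq [w, v] ys"
        using vs_ys subseq_order.trans by blast
      then show False
        using no_pattern[OF sub, of "[w, v]" "[2, 4, 3, 1]"] \<open>v < p\<close> \<open>p < w\<close> vs_less_us[OF w(1) u(1)]
        by (simp add: same_order_2431 del: One_nat_def)
    qed
    ultimately show ?thesis by blast
  qed
  define \<sigma> where "\<sigma> = filter (\<lambda>v. v \<le> n) xs"
  \<comment> \<open>A high entry to the left of a low one would, by \<open>low\<close>, have to
    occur again on its right.\<close>
  have "sorted_wrt (\<lambda>a b. b \<le> n \<longrightarrow> a \<le> n) xs"
    unfolding sorted_wrt_iff_subseq
  proof (intro allI impI, rule ccontr)
    fix a b assume ab: "subseq [a, b] xs" "b \<le> n" "\<not> a \<le> n"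
    obtain A B where AB: "xs = A @ a # B" "b \<in> set B"
      using list_emb_ConsD[OF ab(1)] by (auto simp: subseq_singleton_left)
    then obtain B1 B2 where "B = B1 @ b # B2"
      by (meson split_list)
    then have "xs = (A @ a # B1) @ b # B2" using AB by simp
    moreover have "a \<in> set us" using ab AB by (simp add: us_def)
    ultimately have "a \<in> set B2"
      using low ab(2) by blast
    then show False
      using distinct_halves(1) \<open>xs = (A @ a # B1) @ b # B2\<close> by simp
  qed
  then have xs_eq: "xs = \<sigma> @ us"
    using append_filters[of "\<lambda>v. v \<le> n" xs] by (simp add: \<sigma>_def us_def not_le)
  \<comment> \<open>The low values outside \<sigma> are those of \<open>vs\<close>, all larger than
    those of \<sigma> by \<open>low\<close>.\<close>
  have "set \<sigma> = {1..n - card (set vs)}"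
  proof (rule initial_segment)
    show "set \<sigma> \<union> set vs = {1..n}"
      using low_values by (auto simp: \<sigma>_def vs_def)
    show "p < v" if "p \<in> set \<sigma>" "v \<in> set vs" for p v
    proof -
      have "p \<in> set xs" "p \<le> n"
        using that(1) by (simp_all add: \<sigma>_def)
      then show ?thesis
        using low that(2) by (meson split_list)
    qed
  qed
  moreover have "card (set vs) = length us"
    using distinct_card[of vs] distinct_halves(2) by (simp add: vs_def) (simp add: vs_eq flip: vs_def)
  ultimately have \<sigma>: "set \<sigma> = {1..n - length us}" by simp
  \<comment> \<open>The mirror image of u lies in \<open>vs\<close>, hence outside \<sigma> and
    above \<open>n - length us\<close>. This bounds u by \<open>n + length us\<close>, and counting
    gives equality.\<close>
  have "set us \<subseteq> {Suc n..<Suc (n + length us)}"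
  proof
    fix u assume u: "u \<in> set us"
    then have "2 * n + 1 - u \<in> set vs"
      by (simp add: vs_eq)
    then have "2 * n + 1 - u \<notin> set \<sigma>"
      using distinct_halves(3) by (auto simp: vs_def \<sigma>_def)
    then show "u \<in> {Suc n..<Suc (n + length us)}"
      using in_us[OF u] by (auto simp: \<sigma>)
  qed
  then have "set us = {Suc n..<Suc (n + length us)}"
    by (rule card_subset_eq[rotated]) (simp_all add: distinct_card distinct_us)
  then have "rev us = [Suc n..<Suc (n + length us)]"
    using dec by (intro strict_sorted_equal) (auto simp: sorted_wrt_rev simp del: upt_Suc)
  then have "us = rev [Suc n..<Suc (n + length us)]"
    by (metis rev_rev_ident)
  with xs_eq \<sigma> show ?thesis by metis
qed

end

section \<open>Recovering a centrosymmetric permutation from three quadrants\<close>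

lemma list_all2_filter_eq:
  assumes "list_all2 (\<lambda>a b. a \<le> n \<and> a = b \<or> n < a \<and> n < b) xs ys"
    and "filter (\<lambda>v. n < v) xs = filter (\<lambda>v. n < v) ys"
  shows "xs = (ys :: nat list)"
  using assms by (induction rule: list_all2_induct) auto

context centrosymmetric_perm
begin

lemma pi_eq: "\<pi> = xs @ map (\<lambda>v. 2 * n + 1 - v) (rev xs)"
  unfolding ys_eq[symmetric] append_halves ..

lemma us_eq: "us = rev (map (\<lambda>v. 2 * n + 1 - v) vs)"
proof -
  have "map (\<lambda>v. 2 * n + 1 - (2 * n + 1 - v)) us = us"
    using in_us by (intro map_idI) fastforce
  then show ?thesis
    by (simp add: vs_eq rev_map o_def)
qed

lemma distinct_xs_vs: "distinct (xs @ vs)"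
  using distinct_halves by (auto simp: vs_def)

text \<open>By \<open>low_values\<close> all of \<open>{1..n}\<close> occurs, so a low value equals
  its rank and a higher value has rank above n.\<close>

lemma standardize_nth:
  assumes "i < length (xs @ vs)"
  shows "(xs @ vs) ! i \<le> n \<Longrightarrow> standardize (xs @ vs) ! i = (xs @ vs) ! i"
    and "n < (xs @ vs) ! i \<Longrightarrow> n < standardize (xs @ vs) ! i"
proof -
  define v where "v = (xs @ vs) ! i"
  have v: "v \<in> set (xs @ vs)"
    using assms unfolding v_def by (rule nth_mem)
  have nth: "standardize (xs @ vs) ! i = card {y \<in> set (xs @ vs). y \<le> v}"
    using assms unfolding standardize_def v_def by (rule nth_map)
  show "standardize (xs @ vs) ! i = v" if "v \<le> n"
  proof -
    have "{y \<in> set (xs @ vs). y \<le> v} = {y \<in> {y \<in> set (xs @ vs). y \<le> n}. y \<le> v}"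
      using that by auto
    also have "\<dots> = {1..v}"
      unfolding low_values using that by auto
    finally show ?thesis
      unfolding nth by simp
  qed
  show "n < standardize (xs @ vs) ! i" if "n < v"
  proof -
    have "card (insert v {1..n}) \<le> card {y \<in> set (xs @ vs). y \<le> v}"
    proof (rule card_mono)
      have "{1..n} \<subseteq> {y \<in> set (xs @ vs). y \<le> v}"
        unfolding low_values[symmetric] using that by auto
      then show "insert v {1..n} \<subseteq> {y \<in> set (xs @ vs). y \<le> v}"
        using v by blast
    qed simp
    then show ?thesis
      unfolding nth using that by simp
  qed
qed

end

text \<open>\<open>vs\<close> consists of low values, which standardization keeps. The half-turn
  maps it to \<open>us\<close>, which fills the high positions of \<open>xs\<close>; and
  \<open>xs\<close> determines \<pi>.\<close>

lemma standardize_determines: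
  assumes "centrosymmetric_perm \<pi> n" "centrosymmetric_perm \<pi>' n"
    and eq: "standardize (centrosymmetric_perm.xs \<pi> n @ centrosymmetric_perm.vs \<pi> n)
      = standardize (centrosymmetric_perm.xs \<pi>' n @ centrosymmetric_perm.vs \<pi>' n)"
  shows "\<pi> = \<pi>'"
proof -
  interpret p: centrosymmetric_perm \<pi> n by fact
  interpret q: centrosymmetric_perm \<pi>' n by fact
  \<comment> \<open>What equal standardizations give: the same low values, and high values in the
    same positions.\<close>
  let ?R = "\<lambda>a b. a \<le> n \<and> a = b \<or> n < a \<and> n < b"
  have "length (p.xs @ p.vs) = length (q.xs @ q.vs)"
    using arg_cong[OF eq, of length] by (simp only: length_standardize)
  moreover have "?R ((p.xs @ p.vs) ! i) ((q.xs @ q.vs) ! i)"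
    if "i < length (p.xs @ p.vs)" "i < length (q.xs @ q.vs)" for i
    using p.standardize_nth[OF that(1)] q.standardize_nth[OF that(2)] eq
    by (metis not_le)
  ultimately have "list_all2 ?R (p.xs @ p.vs) (q.xs @ q.vs)"
    by (simp only: list_all2_conv_all_nth) simp
  then have R: "list_all2 ?R p.xs q.xs" "list_all2 ?R p.vs q.vs"
    by (simp_all add: list_all2_append p.length_xs q.length_xs)
  have "p.vs = q.vs"
    using R(2) by (rule list_all2_filter_eq) (auto simp: p.vs_def q.vs_def)
  then have "p.us = q.us"
    unfolding p.us_eq q.us_eq by simp
  then have "filter (\<lambda>v. n < v) p.xs = filter (\<lambda>v. n < v) q.xs"
    unfolding p.us_def q.us_def .
  with R(1) have "p.xs = q.xs"
    by (rule list_all2_filter_eq)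
  then have "p.xs @ map (\<lambda>v. 2 * n + 1 - v) (rev p.xs) = q.xs @ map (\<lambda>v. 2 * n + 1 - v) (rev q.xs)"
    by simp
  then show ?thesis
    unfolding p.pi_eq[symmetric] q.pi_eq[symmetric] .
qed

lemma rc_sum_rc:
  assumes "is_perm \<sigma>"
  shows "rc (perm_sum \<sigma> (rc \<sigma>)) = perm_sum \<sigma> (rc \<sigma>)"
proof -
  let ?m = "length \<sigma>"
  have len: "length (perm_sum \<sigma> (rc \<sigma>)) = 2 * ?m"
    by (simp add: perm_sum_def)
  have "rev (perm_sum \<sigma> (rc \<sigma>)) = map (\<lambda>x. ?m + (?m + 1 - x)) \<sigma> @ rev \<sigma>"
    by (simp add: perm_sum_def rc_def rev_map)
  then have "rc (perm_sum \<sigma> (rc \<sigma>)) =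
      map (\<lambda>x. 2 * ?m + 1 - (?m + (?m + 1 - x))) \<sigma> @ map (\<lambda>x. 2 * ?m + 1 - x) (rev \<sigma>)"
    unfolding rc_def[of "perm_sum \<sigma> (rc \<sigma>)"] len by simp
  \<comment> \<open>Entries of \<sigma> are at most \<open>?m\<close>, so the truncated subtractions
    are exact.\<close>
  also have "map (\<lambda>x. 2 * ?m + 1 - (?m + (?m + 1 - x))) \<sigma> = \<sigma>"
    using assms by (intro map_idI) (auto simp: is_perm_iff)
  also have "map (\<lambda>x. 2 * ?m + 1 - x) (rev \<sigma>) = map (\<lambda>x. ?m + x) (rc \<sigma>)"
    using assms by (auto simp: rc_def is_perm_iff)
  finally show ?thesis
    by (simp add: perm_sum_def)
qed

section \<open>Counting centrosymmetric permutations\<close>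

context small_class
begin

lemma card_of_size_le_rc: "card (of_size C n) \<le> card (rc_of_size C (2 * n))"
proof (rule card_inj_on_le)
  show "inj_on (\<lambda>\<sigma>. perm_sum \<sigma> (rc \<sigma>)) (of_size C n)"
    by (auto simp: inj_on_def perm_sum_def of_size_def)
  show "(\<lambda>\<sigma>. perm_sum \<sigma> (rc \<sigma>)) ` of_size C n \<subseteq> rc_of_size C (2 * n)"
  proof clarify
    fix \<sigma> assume "\<sigma> \<in> of_size C n"
    then have "\<sigma> \<in> C" "length \<sigma> = n"
      by (auto simp: of_size_def)
    then have "perm_sum \<sigma> (rc \<sigma>) \<in> C" "length (perm_sum \<sigma> (rc \<sigma>)) = 2 * n"
      using perm_sum_mem[OF _ rc_mem] by (auto simp: perm_sum_def)
    with \<open>\<sigma> \<in> C\<close> show "perm_sum \<sigma> (rc \<sigma>) \<in> rc_of_size C (2 * n)"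
      by (simp add: rc_of_size_def of_size_def centrosymmetric_def is_perm rc_sum_rc)
  qed
  show "finite (rc_of_size C (2 * n))"
    using finite_of_size[OF perm_class] by (simp add: rc_of_size_def)
qed

lemma small_class_centrosymmetricI:
  assumes "\<pi> \<in> rc_of_size C (2 * n)"
  shows "small_class_centrosymmetric C L \<pi> n"
proof
  show "\<pi> \<in> C" "length \<pi> = 2 * n" "centrosymmetric \<pi>"
    using assms by (auto simp: rc_of_size_def of_size_def)
  then show "is_perm \<pi>"
    by (simp add: is_perm)
qed

text \<open>Sort by the number k of entries in the upper left quadrant. For k < 7, standardizing
  three quadrants is injective into size n + k; for k \<ge> 7, the initial part of size n - k
  determines \<pi>.\<close>

lemma card_rc_le:
  "card (rc_of_size C (2 * n)) \<le> (\<Sum>k<7. card (of_size C (n + k))) + (\<Sum>j\<le>n. card (of_size C j))"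
proof -
  let ?S = "rc_of_size C (2 * n)"
  let ?k = "\<lambda>\<pi>. length (centrosymmetric_perm.us \<pi> n)"
  have fin: "finite ?S"
    using finite_of_size[OF perm_class] by (simp add: rc_of_size_def)
  have few: "card {\<pi> \<in> ?S. ?k \<pi> = k} \<le> card (of_size C (n + k))" for k
  proof (rule card_inj_on_le)
    let ?f = "\<lambda>\<pi>. standardize (centrosymmetric_perm.xs \<pi> n @ centrosymmetric_perm.vs \<pi> n)"
    show "inj_on ?f {\<pi> \<in> ?S. ?k \<pi> = k}"
    proof (rule inj_onI)
      fix \<pi> \<pi>' assume S: "\<pi> \<in> {\<pi> \<in> ?S. ?k \<pi> = k}" "\<pi>' \<in> {\<pi> \<in> ?S. ?k \<pi> = k}" and eq: "?f \<pi> = ?f \<pi>'"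
      from S interpret p: small_class_centrosymmetric C L \<pi> n
        by (intro small_class_centrosymmetricI) simp
      from S interpret q: small_class_centrosymmetric C L \<pi>' n
        by (intro small_class_centrosymmetricI) simp
      show "\<pi> = \<pi>'"
        using p.centrosymmetric_perm_axioms q.centrosymmetric_perm_axioms eq
        by (rule standardize_determines)
    qed
    show "?f ` {\<pi> \<in> ?S. ?k \<pi> = k} \<subseteq> of_size C (n + k)"
    proof (rule image_subsetI)
      fix \<pi> assume \<pi>: "\<pi> \<in> {\<pi> \<in> ?S. ?k \<pi> = k}"
      then interpret small_class_centrosymmetric C L \<pi> n
        by (intro small_class_centrosymmetricI) simp
      have "subseq (xs @ vs) \<pi>"
        by (rule subseq_halves) (simp_all add: vs_def)
      then have "standardize (xs @ vs) \<in> C"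
        using pattern_mem[OF mem] same_order_standardize is_perm_standardize distinct_xs_vs by blast
      moreover have "length vs = length us"
        unfolding vs_eq by simp
      ultimately show "?f \<pi> \<in> of_size C (n + k)"
        using \<pi> by (simp add: of_size_def length_xs)
    qed
  qed (rule finite_of_size[OF perm_class])
  have many: "card {\<pi> \<in> ?S. 7 \<le> ?k \<pi>} \<le> card (\<Union>j\<le>n. of_size C j)"
  proof (rule card_inj_on_le)
    let ?f = "\<lambda>\<pi>. take (n - ?k \<pi>) (centrosymmetric_perm.xs \<pi> n)"
    \<comment> \<open>The right-hand side depends on \<open>?f \<pi>\<close> alone: its length is n
      - k, so the block's upper end n + k is \<open>2 * n - length (?f \<pi>)\<close>. Injectivity
      follows.\<close>
    have *: "?f \<pi> \<in> C \<and> length (?f \<pi>) \<le> n \<and> \<pi> = ?f \<pi> @ rev [Suc n..<Suc (2 * n - length (?f \<pi>))] @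
        map (\<lambda>v. 2 * n + 1 - v) (rev (?f \<pi> @ rev [Suc n..<Suc (2 * n - length (?f \<pi>))]))"
      if \<pi>: "\<pi> \<in> {\<pi> \<in> ?S. 7 \<le> ?k \<pi>}" for \<pi>
    proof -
      from \<pi> interpret small_class_centrosymmetric C L \<pi> n
        by (intro small_class_centrosymmetricI) simp
      have "7 \<le> length us" using \<pi> by simp
      moreover from this have "sorted_wrt (>) us"
        using us_monotone increasing_us_short by (meson not_le)
      ultimately obtain \<sigma> where \<sigma>: "xs = \<sigma> @ rev [Suc n..<Suc (n + length us)]" "set \<sigma> = {1..n - length us}"
        using decreasing_us_structure by blast
      have len: "length \<sigma> + length us = n"
        using arg_cong[OF \<sigma>(1), of length] length_xs by (simp del: upt_Suc)
      then have "n - length us = length \<sigma>"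
        by simp
      then have f: "?f \<pi> = \<sigma>"
        unfolding \<sigma>(1) by (simp del: upt_Suc)
      have "distinct \<sigma>"
        using distinct_halves(1) unfolding \<sigma>(1) by simp
      then have perm: "is_perm \<sigma>"
        using \<sigma>(2) len by (auto simp: is_perm_iff)
      have "subseq (\<sigma> @ []) \<pi>"
      proof (rule subseq_halves)
        show "subseq \<sigma> xs"
          unfolding \<sigma>(1) by (rule subseq_rev_drop_many) simp
      qed simp
      then have "\<sigma> \<in> C"
        using perm by (intro pattern_mem[OF mem, of \<sigma>]) (simp_all add: same_order_def)
      moreover have "2 * n - length \<sigma> = n + length us" "length \<sigma> \<le> n"
        using len by simp_all
      moreover have "\<pi> = \<sigma> @ rev [Suc n..<Suc (n + length us)] @
          map (\<lambda>v. 2 * n + 1 - v) (rev (\<sigma> @ rev [Suc n..<Suc (n + length us)]))"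
        unfolding append_assoc[symmetric] \<sigma>(1)[symmetric] by (rule pi_eq)
      ultimately show ?thesis
        unfolding f by metis
    qed
    show "inj_on ?f {\<pi> \<in> ?S. 7 \<le> ?k \<pi>}"
    proof (rule inj_onI)
      fix \<pi> \<pi>' assume "\<pi> \<in> {\<pi> \<in> ?S. 7 \<le> ?k \<pi>}" "\<pi>' \<in> {\<pi> \<in> ?S. 7 \<le> ?k \<pi>}" "?f \<pi> = ?f \<pi>'"
      then show "\<pi> = \<pi>'"
        using *[of \<pi>] *[of \<pi>'] by metis
    qed
    show "?f ` {\<pi> \<in> ?S. 7 \<le> ?k \<pi>} \<subseteq> (\<Union>j\<le>n. of_size C j)"
    proof (rule image_subsetI)
      fix \<pi> assume "\<pi> \<in> {\<pi> \<in> ?S. 7 \<le> ?k \<pi>}"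
      from *[OF this] show "?f \<pi> \<in> (\<Union>j\<le>n. of_size C j)"
        unfolding of_size_def by blast
    qed
  qed (use finite_of_size[OF perm_class] in blast)
  have "card ?S \<le> card ((\<Union>k<7. {\<pi> \<in> ?S. ?k \<pi> = k}) \<union> {\<pi> \<in> ?S. 7 \<le> ?k \<pi>})"
    using fin by (intro card_mono) auto
  also have "\<dots> \<le> card (\<Union>k<7. {\<pi> \<in> ?S. ?k \<pi> = k}) + card {\<pi> \<in> ?S. 7 \<le> ?k \<pi>}"
    by (rule card_Un_le)
  also have "\<dots> \<le> (\<Sum>k<7. card {\<pi> \<in> ?S. ?k \<pi> = k}) + card (\<Union>j\<le>n. of_size C j)"
    by (intro add_mono many card_UN_le) simp
  also have "\<dots> \<le> (\<Sum>k<7. card (of_size C (n + k))) + (\<Sum>j\<le>n. card (of_size C j))"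
    by (intro add_mono sum_mono few card_UN_le) simp
  finally show ?thesis .
qed

text \<open>There are 7 + (n + 1) summands, each at most the count at n + 7, and n + 8 \<le> 9 n.
  The n-th root of 9 n tends to 1.\<close>

lemma card_rc_le_mult:
  assumes "[1] \<in> C" "0 < n"
  shows "card (rc_of_size C (2 * n)) \<le> 9 * n * card (of_size C (n + 7))"
proof -
  let ?c = "card (of_size C (n + 7))"
  have "(\<Sum>k<7. card (of_size C (n + k))) \<le> (\<Sum>k<7::nat. ?c)"
    by (intro sum_mono card_of_size_mono assms) simp
  moreover have "(\<Sum>j\<le>n. card (of_size C j)) \<le> (\<Sum>j\<le>n. ?c)"
    by (intro sum_mono card_of_size_mono assms) simp
  ultimately have "card (rc_of_size C (2 * n)) \<le> (n + 8) * ?c"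
    using card_rc_le[of n] by (simp add: algebra_simps)
  also have "\<dots> \<le> 9 * n * ?c"
    using assms by (intro mult_right_mono) auto
  finally show ?thesis .
qed

end

section \<open>Limits of roots\<close>

lemma root_shift_tendsto:
  fixes c :: "nat \<Rightarrow> real"
  assumes "(\<lambda>n. root n (c n)) \<longlonglongrightarrow> L" "L \<noteq> 0" "\<And>n. 0 < c n"
  shows "(\<lambda>n. root n (c (n + m))) \<longlonglongrightarrow> L"
proof -
  have "0 \<le> L"
    using assms(3) by (intro LIMSEQ_le_const[OF assms(1)]) (auto intro!: exI[of _ 0] real_root_ge_zero intro: less_imp_le)
  have "(\<lambda>n. root (n + m) (c (n + m))) \<longlonglongrightarrow> L"
    using assms(1) by (rule LIMSEQ_ignore_initial_segment)
  moreover have "(\<lambda>n. 1 + real m / real n) \<longlonglongrightarrow> 1 + 0"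
    by (intro tendsto_intros lim_const_over_n)
  \<comment> \<open>The (n + m)-th root raised to the power (n + m) / n = 1 + m / n is the n-th
    root. With L nonzero, \<open>powr\<close> passes to the limit.\<close>
  ultimately have "(\<lambda>n. root (n + m) (c (n + m)) powr (1 + real m / real n)) \<longlonglongrightarrow> L powr (1 + 0)"
    using assms(2) by (rule tendsto_powr)
  moreover have "\<forall>\<^sub>F n in sequentially.
      root (n + m) (c (n + m)) powr (1 + real m / real n) = root n (c (n + m))"
    using eventually_gt_at_top[of 0]
  proof eventually_elim
    case (elim n)
    then have "1 / real (n + m) * (1 + real m / real n) = 1 / real n"
      by (simp add: field_simps)
    moreover have "root (n + m) (c (n + m)) = c (n + m) powr (1 / real (n + m))"
      "root n (c (n + m)) = c (n + m) powr (1 / real n)"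
      using elim assms(3) by (auto intro!: root_powr_inverse intro: less_imp_le simp del: of_nat_add)
    ultimately show ?case
      by (simp only: powr_powr)
  qed
  ultimately have "(\<lambda>n. root n (c (n + m))) \<longlonglongrightarrow> L powr (1 + 0)"
    by (rule Lim_transform_eventually)
  with \<open>0 \<le> L\<close> show ?thesis by simp
qed

theorem theorem1p5:
  fixes C :: "nat list set" and L :: real
  assumes "perm_class C"
    and "sum_closed C"
    and "rc_invariant C"
    and "(\<lambda>n. root n (real (card (of_size C n)))) \<longlonglongrightarrow> L"
    and "L \<le> xi"
  shows "(\<lambda>n. root n (real (card (rc_of_size C (2 * n))))) \<longlonglongrightarrow> L"
proof -
  interpret small_class C L
    by unfold_locales fact+
  show ?thesis
  proof (cases "[1] \<in> C")
    \<comment> \<open>Without \<open>[1]\<close> the class has no nonempty member, so both root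
      sequences are eventually 0.\<close>
    case False
    then have empty: "of_size C n = {}" if "0 < n" for n
      using that one_mem by (auto simp: of_size_def)
    have "\<forall>\<^sub>F n in sequentially. root n (real (card (of_size C n))) = 0"
      using eventually_gt_at_top[of 0] by eventually_elim (simp add: empty)
    then have "L = 0"
      by (rule LIMSEQ_unique[OF lim tendsto_eventually])
    moreover have "\<forall>\<^sub>F n in sequentially. root n (real (card (rc_of_size C (2 * n)))) = 0"
      using eventually_gt_at_top[of 0] by eventually_elim (simp add: rc_of_size_def empty)
    ultimately show ?thesis
      by (simp add: tendsto_eventually)
  next
    case True
    define c where "c n = real (card (of_size C n))" for n
    have c: "1 \<le> c n" for n
      using card_of_size_pos[OF True, of n] by (simp add: c_def)
    \<comment> \<open>This makes L nonzero, as \<open>root_shift_tendsto\<close> requires.\<close>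
    have "1 \<le> L"
      using c by (intro LIMSEQ_le_const[OF lim]) (auto simp flip: c_def intro!: exI[of _ 1])
    then have "(\<lambda>n. root n (c (n + 7))) \<longlonglongrightarrow> L"
      using lim c by (intro root_shift_tendsto) (auto simp: c_def intro: less_le_trans[OF zero_less_one])
    then have upper: "(\<lambda>n. root n 9 * root n (real n) * root n (c (n + 7))) \<longlonglongrightarrow> 1 * 1 * L"
      by (intro tendsto_mult LIMSEQ_root LIMSEQ_root_const) simp_all
    show ?thesis
    proof (rule tendsto_sandwich[OF _ _ lim])
      show "(\<lambda>n. root n 9 * root n (real n) * root n (c (n + 7))) \<longlonglongrightarrow> L"
        using upper by simp
      show "\<forall>\<^sub>F n in sequentially.
          root n (real (card (of_size C n))) \<le> root n (real (card (rc_of_size C (2 * n))))"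
        using eventually_gt_at_top[of 0] by eventually_elim (simp add: card_of_size_le_rc)
      show "\<forall>\<^sub>F n in sequentially. root n (real (card (rc_of_size C (2 * n))))
          \<le> root n 9 * root n (real n) * root n (c (n + 7))"
        using eventually_gt_at_top[of 0]
      proof eventually_elim
        case (elim n)
        have "real (card (rc_of_size C (2 * n))) \<le> real (9 * n * card (of_size C (n + 7)))"
          using card_rc_le_mult[OF True elim] by (rule of_nat_mono)
        then have "root n (real (card (rc_of_size C (2 * n)))) \<le> root n (9 * real n * c (n + 7))"
          using elim by (simp add: c_def)
        then show ?case
          by (simp add: real_root_mult)
      qed
    qed
  qed
qed

end
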